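(* For $n\le 7$, the values $s_1(n,\# P_3,S_4)$ and $s_2(n,\# P_3,S_4)$ are as follows: for $n=1,2,3,4,5,6,7$, $s_1(n,\# P_3,S_4)$ equals $n-1,\ n-2,\ n,\ n,\ n-1,\ n,\ n$ respectively, and $s_2(n,\# P_3,S_4)$ equals $n-1,\ n-2,\ n,\ n,\ n,\ n-1,\ n$ respectively. For $n\ge 8$ and $i\in\{1,2\}$, $$s_i(n,\# P_3,S_4)=\begin{cases} n, & \text{if } n \text{ and } i \text{ have different parity},\\ n-1, & \text{if } n \text{ and } i \text{ have the same parity}.\end{cases}$$
   Context: For graphs $F$ and $H$, the $F$-saturation game on $n$ vertices is played by Max and Mini, who alternately claim previously unclaimed edges of $K_n$ so that the graph $G$ of claimed edges stays $F$-free; the game ends when $G$ is $F$-saturated (no further edge can be added without creating a copy of $F$). The $H$-score is the number of (not necessarily induced) subgraphs of the final $G$ isomorphic to $H$. Max maximizes, Mini minimizes the score; $s_1(n,\# H,F)$ is the optimal score when Max starts and $s_2(n,\# H,F)$ when Mini starts. $P_3$ is the path on 3 vertices and $S_4$ is the star on 4 vertices (so the game graph must keep maximum degree at most 2). *)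

theory Defs
  imports Main
begin

text \<open>Simple graphs, given by a vertex set and a set of two-element edges.\<close>

type_synonym 'a sgraph = "'a set \<times> 'a set set"

abbreviation verts :: "'a sgraph \<Rightarrow> 'a set" where "verts \<equiv> fst"
abbreviation edges :: "'a sgraph \<Rightarrow> 'a set set" where "edges \<equiv> snd"

definition all_edges :: "'a set \<Rightarrow> 'a set set" where
  "all_edges V = {e. e \<subseteq> V \<and> card e = 2}"

definition simple_graph :: "'a sgraph \<Rightarrow> bool" where
  "simple_graph G \<longleftrightarrow> edges G \<subseteq> all_edges (verts G)"

definition subgraph :: "'a sgraph \<Rightarrow> 'a sgraph \<Rightarrow> bool" where
  "subgraph K G \<longleftrightarrow> simple_graph K \<and> verts K \<subseteq> verts G \<and> edges K \<subseteq> edges G"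

definition isomorphic :: "'a sgraph \<Rightarrow> 'b sgraph \<Rightarrow> bool" where
  "isomorphic G H \<longleftrightarrow>
     (\<exists>f. bij_betw f (verts G) (verts H) \<and> edges H = (\<lambda>e. f ` e) ` edges G)"

definition copies :: "'b sgraph \<Rightarrow> 'a sgraph \<Rightarrow> 'a sgraph set" where
  "copies H G = {K. subgraph K G \<and> isomorphic H K}"

definition free_of :: "'b sgraph \<Rightarrow> 'a sgraph \<Rightarrow> bool" where
  "free_of F G \<longleftrightarrow> copies F G = {}"

definition saturated :: "'b sgraph \<Rightarrow> 'a sgraph \<Rightarrow> bool" where
  "saturated F G \<longleftrightarrow> free_of F G \<and>
     (\<forall>e \<in> all_edges (verts G) - edges G. \<not> free_of F (verts G, insert e (edges G)))"

definition score :: "'b sgraph \<Rightarrow> 'a sgraph \<Rightarrow> nat" where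
  "score H G = card (copies H G)"

definition path_graph :: "nat \<Rightarrow> nat sgraph" where
  "path_graph k = ({..<k}, {{i, Suc i} |i. Suc i < k})"

text \<open>The star on \<open>k\<close> vertices in total, that is, with \<open>k - 1\<close> leaves.\<close>

definition star_graph :: "nat \<Rightarrow> nat sgraph" where
  "star_graph k = ({..<k}, {{0, i} |i. 0 < i \<and> i < k})"

datatype player = Max_Player | Mini_Player

fun opponent :: "player \<Rightarrow> player" where
  "opponent Max_Player = Mini_Player"
| "opponent Mini_Player = Max_Player"

definition legal_moves :: "'b sgraph \<Rightarrow> nat \<Rightarrow> nat set set \<Rightarrow> nat set set" where
  "legal_moves F n E = {e \<in> all_edges {..<n} - E. free_of F ({..<n}, insert e E)}"

lemma saturated_iff_no_legal_moves:
  "free_of F ({..<n}, E) \<Longrightarrow> saturated F ({..<n}, E) \<longleftrightarrow> legal_moves F n E = {}"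
  by (auto simp: saturated_def legal_moves_def)

text \<open>
  The final score under optimal play on the vertex set \<open>{..<n}\<close> when the edges in \<open>E\<close> have been
  claimed and player \<open>p\<close> is to move. For an \<open>F\<close>-free position, having no legal move
  is the same as being \<open>F\<close>-saturated (lemma \<open>saturated_iff_no_legal_moves\<close>).
\<close>

function game_value ::
  "'c sgraph \<Rightarrow> 'b sgraph \<Rightarrow> nat \<Rightarrow> player \<Rightarrow> nat set set \<Rightarrow> nat" where
  "game_value H F n p E =
     (if legal_moves F n E = {} then score H ({..<n}, E)
      else case p of
        Max_Player \<Rightarrow>
          Max ((\<lambda>e. game_value H F n (opponent p) (insert e E)) ` legal_moves F n E)
      | Mini_Player \<Rightarrow>
          Min ((\<lambda>e. game_value H F n (opponent p) (insert e E)) ` legal_moves F n E))"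
  by pat_completeness auto
termination
proof (relation "measure (\<lambda>(H, F, n, p, E). card (all_edges {..<n} - E))", simp)
  have "card (all_edges {..<n} - insert e E) < card (all_edges {..<n} - E)"
    if "e \<in> legal_moves F n E" for F :: "'b sgraph" and n e E
  proof (rule psubset_card_mono)
    show "finite (all_edges {..<n} - E)"
      by (rule finite_subset [of _ "Pow {..<n}"]) (auto simp: all_edges_def)
    show "all_edges {..<n} - insert e E \<subset> all_edges {..<n} - E"
      using that by (auto simp: legal_moves_def)
  qed
  then show "((H, F, n, opponent p, insert e E), (H, F, n, p, E)) \<in>
      measure (\<lambda>(H, F, n, p, E). card (all_edges {..<n} - E))"
    if "e \<in> legal_moves F n E"
    for H :: "'c sgraph" and F :: "'b sgraph" and n p E e
    using that by simp
  then show "((H, F, n, opponent p, insert e E), (H, F, n, p, E)) \<in>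
      measure (\<lambda>(H, F, n, p, E). card (all_edges {..<n} - E))"
    if "e \<in> legal_moves F n E"
    for H :: "'c sgraph" and F :: "'b sgraph" and n p E e
    using that by blast
qed

declare game_value.simps [simp del]

text \<open>
  \<open>sat_score i n H F\<close> is the value of the \<open>F\<close>-saturation game on \<open>n\<close> vertices with
  \<open>H\<close>-score, for \<open>i\<close> in \<open>{1, 2}\<close>: Max starts if \<open>i = 1\<close>, Mini if \<open>i = 2\<close>.
\<close>

definition sat_score :: "nat \<Rightarrow> nat \<Rightarrow> 'c sgraph \<Rightarrow> 'b sgraph \<Rightarrow> nat" where
  "sat_score i n H F = game_value H F n (if i = 1 then Max_Player else Mini_Player) {}"

end

theory Submission
  imports Defs begin

text \<open>
  A graph of maximum degree at most 2 is a disjoint union of paths and cycles. For the game only the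
  triple \<open>(a, b, c)\<close> matters, where \<open>a\<close> counts the isolated vertices, \<open>b\<close> the components that
  are a single edge and \<open>c\<close> the paths on at least three vertices. Every move lowers
  \<open>a + b + c\<close> by 1; closing a long path and joining two long paths have the same effect on the
  triple. The number of copies of \<open>P\<^sub>3\<close> is the number of vertices of degree 2, so that a finished
  game scores \<open>n\<close>, \<open>n - 1\<close> (an isolated vertex is left) or \<open>n - 2\<close> (an isolated edge is left).
  The value of the game on triples has a closed form, which is verified by induction.
\<close>

section \<open>Neighbourhoods and small subgraphs\<close>

definition nbrs :: "'a set set \<Rightarrow> 'a \<Rightarrow> 'a set" where
  "nbrs E v = {w. {v, w} \<in> E}"

lemma nbrs_sym: "w \<in> nbrs E v \<longleftrightarrow> v \<in> nbrs E w"
  by (simp add: nbrs_def insert_commute)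

lemma nbrs_empty [simp]: "nbrs {} v = {}"
  by (simp add: nbrs_def)

lemma nbrs_insert:
  "nbrs (insert {x, y} E) v =
    (if v = x then insert y (nbrs E x) else if v = y then insert x (nbrs E y) else nbrs E v)"
  by (auto simp: nbrs_def doubleton_eq_iff)

lemma nbrs_edge:
  assumes "E \<subseteq> all_edges V" "w \<in> nbrs E v"
  shows "v \<in> V" "w \<in> V" "v \<noteq> w"
  using assms by (auto simp: nbrs_def all_edges_def)

lemma finite_nbrs: "finite V \<Longrightarrow> E \<subseteq> all_edges V \<Longrightarrow> finite (nbrs E v)"
  by (rule finite_subset[of _ V]) (auto dest: nbrs_edge)

lemma all_edgesE:
  assumes "e \<in> all_edges V"
  obtains x y where "e = {x, y}" "x \<noteq> y" "x \<in> V" "y \<in> V"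
  using assms unfolding all_edges_def by (auto simp: card_2_iff)

section \<open>Copies of the path and the star expressed through degrees\<close>

lemma isomorphic_path_graph_3_iff:
  "isomorphic (path_graph 3) K \<longleftrightarrow>
    (\<exists>x y z. x \<noteq> y \<and> y \<noteq> z \<and> x \<noteq> z \<and> K = ({x, y, z}, {{x, y}, {y, z}}))"
proof
  have P: "path_graph 3 = ({0, 1, 2}, {{0, 1}, {1, 2}})"
    by (auto simp: path_graph_def numeral_eq_Suc less_Suc_eq)
  show "\<exists>x y z. x \<noteq> y \<and> y \<noteq> z \<and> x \<noteq> z \<and> K = ({x, y, z}, {{x, y}, {y, z}})"
    if "isomorphic (path_graph 3) K"
  proof -
    from that obtain f where f: "bij_betw f {0, 1, 2 :: nat} (verts K)"
      and e: "edges K = (\<lambda>e. f ` e) ` {{0, 1}, {1, 2}}"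
      by (auto simp: isomorphic_def P)
    have "verts K = {f 0, f 1, f 2}"
      using bij_betw_imp_surj_on[OF f] by auto
    moreover have "f 0 \<noteq> f 1" "f 1 \<noteq> f 2" "f 0 \<noteq> f 2"
      using bij_betw_imp_inj_on[OF f] by (auto simp: inj_on_def)
    ultimately show ?thesis
      using e by (intro exI[of _ "f 0"] exI[of _ "f 1"] exI[of _ "f 2"]) (auto simp: prod_eq_iff)
  qed
  show "isomorphic (path_graph 3) K"
    if "\<exists>x y z. x \<noteq> y \<and> y \<noteq> z \<and> x \<noteq> z \<and> K = ({x, y, z}, {{x, y}, {y, z}})"
  proof -
    from that obtain x y z where "x \<noteq> y" "y \<noteq> z" "x \<noteq> z" "K = ({x, y, z}, {{x, y}, {y, z}})"
      by blast
    then show ?thesis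
      unfolding isomorphic_def P
      by (intro exI[of _ "\<lambda>i. if i = 0 then x else if i = 1 then y else z"])
        (auto simp: bij_betw_def inj_on_def)
  qed
qed

lemma isomorphic_star_graph_4_iff:
  "isomorphic (star_graph 4) K \<longleftrightarrow>
    (\<exists>v x y z. distinct [v, x, y, z] \<and> K = ({v, x, y, z}, {{v, x}, {v, y}, {v, z}}))"
proof
  have S: "star_graph 4 = ({0, 1, 2, 3}, {{0, 1}, {0, 2}, {0, 3}})"
    by (auto simp: star_graph_def numeral_eq_Suc less_Suc_eq)
  show "\<exists>v x y z. distinct [v, x, y, z] \<and> K = ({v, x, y, z}, {{v, x}, {v, y}, {v, z}})"
    if "isomorphic (star_graph 4) K"
  proof -
    from that obtain f where f: "bij_betw f {0, 1, 2, 3 :: nat} (verts K)"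
      and e: "edges K = (\<lambda>e. f ` e) ` {{0, 1}, {0, 2}, {0, 3}}"
      by (auto simp: isomorphic_def S)
    have "verts K = {f 0, f 1, f 2, f 3}"
      using bij_betw_imp_surj_on[OF f] by auto
    moreover have "distinct [f 0, f 1, f 2, f 3]"
      using bij_betw_imp_inj_on[OF f] by (auto simp: inj_on_def)
    ultimately show ?thesis
      using e by (intro exI[of _ "f 0"] exI[of _ "f 1"] exI[of _ "f 2"] exI[of _ "f 3"])
        (auto simp: prod_eq_iff)
  qed
  show "isomorphic (star_graph 4) K"
    if "\<exists>v x y z. distinct [v, x, y, z] \<and> K = ({v, x, y, z}, {{v, x}, {v, y}, {v, z}})"
  proof -
    from that obtain v x y z
      where "distinct [v, x, y, z]" "K = ({v, x, y, z}, {{v, x}, {v, y}, {v, z}})"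
      by blast
    then show ?thesis
      unfolding isomorphic_def S
      by (intro exI[of _ "\<lambda>i. if i = 0 then v else if i = 1 then x else if i = 2 then y else z"])
        (auto simp: bij_betw_def inj_on_def)
  qed
qed

text \<open>Any three neighbours of \<open>v\<close> are the leaves of a star with centre
  \<open>v\<close>. The right-hand side may range over all \<open>v\<close> of the type, because
  vertices outside \<open>V\<close> have no neighbours.\<close>

lemma free_of_star_graph_4_iff:
  assumes "finite V" "E \<subseteq> all_edges V"
  shows "free_of (star_graph 4) (V, E) \<longleftrightarrow> (\<forall>v. card (nbrs E v) \<le> 2)"
proof
  assume free: "free_of (star_graph 4) (V, E)"
  show "\<forall>v. card (nbrs E v) \<le> 2"
  proof (rule allI, rule ccontr)
    fix v assume "\<not> card (nbrs E v) \<le> 2"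
    then have "3 \<le> card (nbrs E v)" by simp
    then obtain T where "T \<subseteq> nbrs E v" "card T = 3"
      by (rule obtain_subset_with_card_n)
    then obtain x y z where "x \<in> nbrs E v" "y \<in> nbrs E v" "z \<in> nbrs E v"
      and "x \<noteq> y" "y \<noteq> z" "x \<noteq> z"
      by (auto simp: card_3_iff)
    moreover from this have "v \<in> V" "x \<in> V" "y \<in> V" "z \<in> V" "v \<noteq> x" "v \<noteq> y" "v \<noteq> z"
      using nbrs_edge[OF assms(2)] by blast+
    ultimately have "({v, x, y, z}, {{v, x}, {v, y}, {v, z}}) \<in> copies (star_graph 4) (V, E)"
      by (auto simp: copies_def isomorphic_star_graph_4_iff subgraph_def simple_graph_def
          all_edges_def nbrs_def)
    with free show False by (simp add: free_of_def)
  qed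
next
  assume deg: "\<forall>v. card (nbrs E v) \<le> 2"
  show "free_of (star_graph 4) (V, E)"
  proof (rule ccontr)
    assume "\<not> free_of (star_graph 4) (V, E)"
    then obtain v x y z where *: "distinct [v, x, y, z]" "{v, x} \<in> E" "{v, y} \<in> E" "{v, z} \<in> E"
      by (auto simp: free_of_def copies_def isomorphic_star_graph_4_iff subgraph_def)
    then have "card {x, y, z} = 3" "{x, y, z} \<subseteq> nbrs E v"
      by (auto simp: nbrs_def)
    then have "3 \<le> card (nbrs E v)"
      using card_mono[OF finite_nbrs[OF assms]] by metis
    with deg show False by (auto dest: spec[of _ v])
  qed
qed

text \<open>A copy of the path is determined by its middle vertex as soon as no vertex has a third
  neighbour, and the possible middle vertices are those of degree 2.\<close>

lemma score_path_graph_3: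
  assumes "finite V" "E \<subseteq> all_edges V" "\<And>v. card (nbrs E v) \<le> 2"
  shows "score (path_graph 3) (V, E) = card {v \<in> V. card (nbrs E v) = 2}"
proof -
  let ?K = "\<lambda>v. (insert v (nbrs E v), (\<lambda>w. {v, w}) ` nbrs E v)"
  let ?C = "{v \<in> V. card (nbrs E v) = 2}"
  have "inj_on ?K ?C"
  proof (rule inj_onI)
    \<comment> \<open>The middle vertex is recovered from the copy as the only common vertex of its
      two edges.\<close>
    have "\<Inter> (edges (?K v)) = {v}" if "v \<in> ?C" for v
      using that by (auto simp: card_2_iff)
    then show "u = v" if "u \<in> ?C" "v \<in> ?C" "?K u = ?K v" for u v
      using that by (metis (no_types, lifting) singleton_inject)
  qed
  moreover have "copies (path_graph 3) (V, E) = ?K ` ?C"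
  proof (intro set_eqI iffI)
    fix K assume "K \<in> copies (path_graph 3) (V, E)"
    then obtain x v z where K: "x \<noteq> v" "v \<noteq> z" "x \<noteq> z" "K = ({x, v, z}, {{x, v}, {v, z}})"
      and "{x, v} \<in> E" "{v, z} \<in> E" "v \<in> V"
      by (auto simp: copies_def isomorphic_path_graph_3_iff subgraph_def)
    then have "{x, z} \<subseteq> nbrs E v" "card {x, z} = 2"
      by (auto simp: nbrs_def insert_commute)
    moreover have "finite (nbrs E v)"
      by (rule finite_nbrs[OF assms(1,2)])
    ultimately have "nbrs E v = {x, z}"
      using assms(3)[of v] card_seteq by metis
    with K \<open>v \<in> V\<close> show "K \<in> ?K ` ?C"
      by (intro image_eqI[of _ _ v]) (auto simp: insert_commute)
  next
    fix K assume "K \<in> ?K ` ?C"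
    then obtain v x z where v: "v \<in> V" and n: "nbrs E v = {x, z}" and "x \<noteq> z" and K: "K = ?K v"
      by (auto simp: card_2_iff)
    have V: "x \<in> V" "z \<in> V" "v \<noteq> x" "v \<noteq> z" and "{v, x} \<in> E" "{v, z} \<in> E"
      using nbrs_edge[OF assms(2), of _ v] n by (auto simp: nbrs_def)
    have Keq: "K = ({x, v, z}, {{x, v}, {v, z}})"
      using n K by (auto simp: insert_commute)
    then have "isomorphic (path_graph 3) K"
      unfolding isomorphic_path_graph_3_iff
      using V \<open>x \<noteq> z\<close> by (intro exI[of _ x] exI[of _ v] exI[of _ z]) simp
    moreover have "subgraph K (V, E)"
      using V v \<open>{v, x} \<in> E\<close> \<open>{v, z} \<in> E\<close>
      by (auto simp: Keq subgraph_def simple_graph_def all_edges_def insert_commute)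
    ultimately show "K \<in> copies (path_graph 3) (V, E)"
      by (simp add: copies_def)
  qed
  ultimately show ?thesis
    by (simp add: score_def card_image)
qed

section \<open>The game on triples\<close>

text \<open>The six clauses, in order: join two isolated vertices; an isolated vertex and a single
  edge; an isolated vertex and a long path; two single edges; a single edge and a long path;
  finally, close a long path or join two of them.\<close>

definition successors :: "nat \<times> nat \<times> nat \<Rightarrow> (nat \<times> nat \<times> nat) set" where
  "successors s = (case s of (a, b, c) \<Rightarrow>
    (if 2 \<le> a then {(a - 2, b + 1, c)} else {}) \<union>
    (if 1 \<le> a \<and> 1 \<le> b then {(a - 1, b - 1, c + 1)} else {}) \<union>
    (if 1 \<le> a \<and> 1 \<le> c then {(a - 1, b, c)} else {}) \<union>
    (if 2 \<le> b then {(a, b - 2, c + 1)} else {}) \<union>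
    (if 1 \<le> b \<and> 1 \<le> c then {(a, b - 1, c)} else {}) \<union>
    (if 1 \<le> c then {(a, b, c - 1)} else {}))"

text \<open>
  The closed form below, for \<open>n\<close> minus the final score under optimal play, was read off a table of
  values computed by backward induction. For \<open>a \<ge> 9\<close> it is governed by the parity of
  \<open>a + b + c\<close>, which determines who makes the last move, and by a bound on \<open>b + c\<close>: Mini to move
  needs \<open>b + c \<le> 3\<close>, so that she can return to \<open>b + c \<le> 2\<close>. The other clauses are exceptions for
  small \<open>a\<close>.
\<close>

fun deficit :: "player \<Rightarrow> nat \<times> nat \<times> nat \<Rightarrow> nat" where
  "deficit Max_Player (a, b, c) =
    (if c = 0 \<and> (a = 0 \<and> odd b \<or> a = 2 \<and> b = 0) then 2
     else if odd (a + b + c) \<and>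
       (a \<ge> 9 \<and> b + c \<le> 2 \<or>
        c = 0 \<and> (a \<le> 1 \<or> b \<le> 4 \<and> a \<in> {4, 5} \<or> b = 1 \<and> a \<ge> 4) \<or>
        c = 1 \<and> b \<le> 1 \<and> (a \<in> {2, 3} \<or> a \<ge> 6))
     then 1 else 0)"
| "deficit Mini_Player (a, b, c) =
    (if c = 0 \<and> (a = 2 \<and> even b \<or> a = 0 \<and> b = 1) \<or>
        c = 1 \<and> (a = 0 \<and> odd b \<or> a = 2 \<and> b = 0) then 2
     else if a = 1 \<and> b = 0 \<and> c = 0 \<or> even (a + b + c) \<and>
       (a \<ge> 9 \<and> b + c \<le> 3 \<or>
        c = 0 \<and> (a = 3 \<or> b \<le> 3 \<and> a \<ge> 6 \<or> b = 2 \<and> a = 4) \<or>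
        c = 1 \<and> (b \<le> 2 \<or> b \<le> 4 \<and> a \<in> {4, 5} \<or> a \<le> 1) \<or>
        c = 2 \<and> b \<le> 1 \<and> (a \<in> {2, 3} \<or> a \<ge> 6))
     then 1 else 0)"

section \<open>Verification of the closed form by a finite case split\<close>

text \<open>Meant for \<open>b\<close> and \<open>c\<close>, which \<open>deficit\<close> compares
  with constants up to 4; the analogue with 9 serves \<open>a\<close>. Writing a large entry as
  \<open>m + 5\<close> or \<open>m + 9\<close> also makes the truncated subtractions in
  \<open>successors\<close>, by at most 2, explicit.\<close>

lemma small_or_ge_5: "n = 0 \<or> n = 1 \<or> n = 2 \<or> n = 3 \<or> n = 4 \<or> (\<exists>m. n = m + (5::nat))"
  by presburger

lemma small_or_ge_9:
  "n = 0 \<or> n = 1 \<or> n = 2 \<or> n = 3 \<or> n = 4 \<or> n = 5 \<or> n = 6 \<or> n = 7 \<or> n = 8 \<or>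
    (\<exists>m. n = m + (9::nat))"
  by presburger

text \<open>A high score is a low deficit, so Max minimizes \<open>deficit\<close> over the
  successors and Mini maximizes it. This recursion is split into four facts: for each player, a
  bound valid for all moves and a move that attains it.\<close>

lemma deficit_Max_le:
  "\<forall>s' \<in> successors (a, b, c). deficit Max_Player (a, b, c) \<le> deficit Mini_Player s'"
  using small_or_ge_5[of c] small_or_ge_5[of b] small_or_ge_9[of a]
  by (elim disjE exE; hypsubst; simp add: successors_def)

text \<open>The assumption says that the triple is not terminal, see
  \<open>successors_empty_iff\<close>.\<close>

lemma deficit_Max_attained:
  assumes "2 \<le> a + b + c \<or> 0 < c"
  shows "\<exists>s' \<in> successors (a, b, c). deficit Mini_Player s' \<le> deficit Max_Player (a, b, c)"
  using small_or_ge_5[of c] small_or_ge_5[of b] small_or_ge_9[of a] assms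
  by (elim disjE exE; hypsubst; simp add: successors_def ex_disj_distrib)

lemma deficit_Mini_ge:
  "\<forall>s' \<in> successors (a, b, c). deficit Max_Player s' \<le> deficit Mini_Player (a, b, c)"
  using small_or_ge_5[of c] small_or_ge_5[of b] small_or_ge_9[of a]
  by (elim disjE exE; hypsubst; simp add: successors_def)

lemma deficit_Mini_attained:
  assumes "2 \<le> a + b + c \<or> 0 < c"
  shows "\<exists>s' \<in> successors (a, b, c). deficit Mini_Player (a, b, c) \<le> deficit Max_Player s'"
  using small_or_ge_5[of c] small_or_ge_5[of b] small_or_ge_9[of a] assms
  by (elim disjE exE; hypsubst; simp add: successors_def ex_disj_distrib)

section \<open>Positions of the game\<close>

text \<open>
  A vertex of degree 1 belongs to \<open>pair_verts\<close> if its component is a single edge and to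
  \<open>end_verts\<close> if it is an end of a longer path. Counting these vertices, two per path, avoids any
  reference to connectivity: a move changes the class of the two chosen vertices and of their
  neighbours only.
\<close>

definition iso_verts :: "nat \<Rightarrow> nat set set \<Rightarrow> nat set" where
  "iso_verts n E = {v. v < n \<and> nbrs E v = {}}"

definition pair_verts :: "nat \<Rightarrow> nat set set \<Rightarrow> nat set" where
  "pair_verts n E = {v. v < n \<and> (\<exists>w. nbrs E v = {w} \<and> nbrs E w = {v})}"

definition end_verts :: "nat \<Rightarrow> nat set set \<Rightarrow> nat set" where
  "end_verts n E = {v. v < n \<and> (\<exists>w. nbrs E v = {w} \<and> nbrs E w \<noteq> {v})}"

lemmas vert_defs = iso_verts_def pair_verts_def end_verts_def

lemma finite_verts [simp]:
  "finite (iso_verts n E)" "finite (pair_verts n E)" "finite (end_verts n E)"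
  by (auto simp: vert_defs)

section \<open>Classes of vertices and the locality of a move\<close>

lemma isolated_class:
  assumes "nbrs E v = {}" "v < n"
  shows "v \<in> iso_verts n E" "v \<notin> pair_verts n E" "v \<notin> end_verts n E"
  using assms by (auto simp: vert_defs)

lemma pair_class:
  assumes "nbrs E v = {w}" "nbrs E w = {v}" "v < n"
  shows "v \<notin> iso_verts n E" "v \<in> pair_verts n E" "v \<notin> end_verts n E"
  using assms by (auto simp: vert_defs)

lemma end_class:
  assumes "nbrs E v = {w}" "nbrs E w \<noteq> {v}" "v < n"
  shows "v \<notin> iso_verts n E" "v \<notin> pair_verts n E" "v \<in> end_verts n E"
  using assms by (auto simp: vert_defs)

lemma inner_class:
  assumes "u \<in> nbrs E v" "w \<in> nbrs E v" "u \<noteq> w"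
  shows "v \<notin> iso_verts n E" "v \<notin> pair_verts n E" "v \<notin> end_verts n E"
  using assms by (auto simp: vert_defs)

text \<open>The class of \<open>v\<close> depends only on the neighbours of \<open>v\<close> and, if
  there is just one neighbour \<open>w\<close>, on those of \<open>w\<close>. Since \<open>v\<close>
  is adjacent to neither \<open>x\<close> nor \<open>y\<close>, this \<open>w\<close> is not an end
  of the new edge.\<close>

lemma class_unchanged:
  assumes "v \<noteq> x" "v \<noteq> y" "v \<notin> nbrs E x" "v \<notin> nbrs E y"
  shows "v \<in> iso_verts n (insert {x, y} E) \<longleftrightarrow> v \<in> iso_verts n E"
    "v \<in> pair_verts n (insert {x, y} E) \<longleftrightarrow> v \<in> pair_verts n E"
    "v \<in> end_verts n (insert {x, y} E) \<longleftrightarrow> v \<in> end_verts n E"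
proof -
  have "nbrs (insert {x, y} E) v = nbrs E v"
    using assms by (simp add: nbrs_insert)
  moreover have "nbrs (insert {x, y} E) w = nbrs E w" if "nbrs E v = {w}" for w
    using that assms nbrs_sym[of v E] by (auto simp: nbrs_insert)
  ultimately show "v \<in> iso_verts n (insert {x, y} E) \<longleftrightarrow> v \<in> iso_verts n E"
    "v \<in> pair_verts n (insert {x, y} E) \<longleftrightarrow> v \<in> pair_verts n E"
    "v \<in> end_verts n (insert {x, y} E) \<longleftrightarrow> v \<in> end_verts n E"
    by (auto simp: vert_defs)
qed

text \<open>The sets differ only inside \<open>S\<close>. The additive form avoids truncated
  subtraction.\<close>

lemma card_exchange:
  assumes "finite A" "finite B" "finite S" "A - S = B - S"
  shows "card B + card (S \<inter> A) = card A + card (S \<inter> B)"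
proof -
  have "card X = card (X - S) + card (S \<inter> X)" if "finite X" for X
    using that by (subst Int_commute, subst card_Diff_subset_Int) (auto simp: card_mono)
  from this[OF assms(1)] this[OF assms(2)] show ?thesis
    using assms(4) by simp
qed

text \<open>Reduces the effect of a move on the three counts to an inspection of a small set
  \<open>S\<close>, which in the applications has at most four elements.\<close>

lemma card_verts_insert:
  assumes "finite S" "{x, y} \<union> nbrs E x \<union> nbrs E y \<subseteq> S"
  shows "card (iso_verts n (insert {x, y} E)) + card (S \<inter> iso_verts n E) =
      card (iso_verts n E) + card (S \<inter> iso_verts n (insert {x, y} E))"
    "card (pair_verts n (insert {x, y} E)) + card (S \<inter> pair_verts n E) =
      card (pair_verts n E) + card (S \<inter> pair_verts n (insert {x, y} E))"
    "card (end_verts n (insert {x, y} E)) + card (S \<inter> end_verts n E) =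
      card (end_verts n E) + card (S \<inter> end_verts n (insert {x, y} E))"
proof -
  have *: "v \<noteq> x" "v \<noteq> y" "v \<notin> nbrs E x" "v \<notin> nbrs E y" if "v \<notin> S" for v
    using that assms(2) by auto
  show "card (iso_verts n (insert {x, y} E)) + card (S \<inter> iso_verts n E) =
      card (iso_verts n E) + card (S \<inter> iso_verts n (insert {x, y} E))"
    using class_unchanged(1)[OF *] assms(1) by (intro card_exchange) auto
  show "card (pair_verts n (insert {x, y} E)) + card (S \<inter> pair_verts n E) =
      card (pair_verts n E) + card (S \<inter> pair_verts n (insert {x, y} E))"
    using class_unchanged(2)[OF *] assms(1) by (intro card_exchange) auto
  show "card (end_verts n (insert {x, y} E)) + card (S \<inter> end_verts n E) =
      card (end_verts n E) + card (S \<inter> end_verts n (insert {x, y} E))"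
    using class_unchanged(3)[OF *] assms(1) by (intro card_exchange) auto
qed

section \<open>Positions and legal moves\<close>

text \<open>The invariant that ties an edge set to its triple. The factor 2 counts both ends of each
  path; evenness of the two counts is carried along by the invariant instead of being derived from
  the component structure.\<close>

definition position :: "nat \<Rightarrow> nat set set \<Rightarrow> nat \<times> nat \<times> nat \<Rightarrow> bool" where
  "position n E s \<longleftrightarrow> E \<subseteq> all_edges {..<n} \<and> (\<forall>v. card (nbrs E v) \<le> 2) \<and>
    (case s of (a, b, c) \<Rightarrow>
      card (iso_verts n E) = a \<and> card (pair_verts n E) = 2 * b \<and> card (end_verts n E) = 2 * c)"

definition playable :: "nat \<Rightarrow> nat set set \<Rightarrow> nat \<Rightarrow> nat \<Rightarrow> bool" where
  "playable n E x y \<longleftrightarrow> x < n \<and> y < n \<and> x \<noteq> y \<and> y \<notin> nbrs E x \<and>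
     card (nbrs E x) \<le> 1 \<and> card (nbrs E y) \<le> 1"

lemma playable_sym: "playable n E x y \<Longrightarrow> playable n E y x"
  using nbrs_sym[of x E y] by (auto simp: playable_def)

text \<open>A new edge raises only the degrees of its two ends, each by one, so the bound 2 survives
  exactly when both degrees were at most 1.\<close>

lemma legal_moves_eq:
  assumes "position n E s"
  shows "legal_moves (star_graph 4) n E = {{x, y} |x y. playable n E x y}"
proof -
  have E: "E \<subseteq> all_edges {..<n}" and deg: "\<And>v. card (nbrs E v) \<le> 2"
    using assms by (auto simp: position_def)
  have fin: "finite (nbrs E v)" for v
    using finite_nbrs[OF _ E] by simp
  have "free_of (star_graph 4) ({..<n}, insert {x, y} E) \<longleftrightarrow>
      card (nbrs E x) \<le> 1 \<and> card (nbrs E y) \<le> 1"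
    if "{x, y} \<in> all_edges {..<n}" "x \<noteq> y" "{x, y} \<notin> E" for x y
  proof -
    have "y \<notin> nbrs E x" "x \<notin> nbrs E y"
      using that by (auto simp: nbrs_def insert_commute)
    then show ?thesis
      using that E fin deg by (subst free_of_star_graph_4_iff) (auto simp: nbrs_insert split: if_splits)
  qed
  then have *: "{x, y} \<in> legal_moves (star_graph 4) n E \<longleftrightarrow> playable n E x y" if "x \<noteq> y" for x y
    using that by (auto simp: legal_moves_def playable_def nbrs_def all_edges_def)
  show ?thesis
  proof (intro set_eqI iffI)
    fix e assume e: "e \<in> legal_moves (star_graph 4) n E"
    then obtain x y where "e = {x, y}" "x \<noteq> y"
      by (auto simp: legal_moves_def elim: all_edgesE)
    with e * show "e \<in> {{x, y} |x y. playable n E x y}"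
      by blast
  qed (use * in \<open>auto simp: playable_def\<close>)
qed

lemma position_insertI:
  assumes "position n E s" "playable n E x y"
    and "card (iso_verts n (insert {x, y} E)) = a" "card (pair_verts n (insert {x, y} E)) = 2 * b"
      "card (end_verts n (insert {x, y} E)) = 2 * c"
  shows "position n (insert {x, y} E) (a, b, c)"
proof -
  have E: "E \<subseteq> all_edges {..<n}" and deg: "\<And>v. card (nbrs E v) \<le> 2"
    using assms(1) by (auto simp: position_def)
  have "finite (nbrs E v)" for v
    using finite_nbrs[OF _ E] by simp
  then have "card (nbrs (insert {x, y} E) v) \<le> 2" for v
    using assms(2) deg[of v] nbrs_sym[of x E y]
    by (auto simp: nbrs_insert playable_def)
  moreover have "insert {x, y} E \<subseteq> all_edges {..<n}"
    using E assms(2) by (auto simp: playable_def all_edges_def)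
  ultimately show ?thesis
    using assms(3-5) by (simp add: position_def)
qed

section \<open>The effect of the six kinds of moves on the triple\<close>

text \<open>All six lemmas follow one pattern: \<open>old\<close> and \<open>new\<close> record the
  classes of the affected vertices before and after the move, \<open>card_verts_insert\<close> turns
  them into counts, and the lower bounds on the entries make the subtractions genuine.\<close>

lemma position_iso_iso:
  assumes pos: "position n E (a, b, c)" and play: "playable n E x y"
    and x: "nbrs E x = {}" and y: "nbrs E y = {}"
  shows "2 \<le> a" "position n (insert {x, y} E) (a - 2, b + 1, c)"
proof -
  let ?E = "insert {x, y} E"
  have d: "x \<noteq> y" "x < n" "y < n"
    using play by (auto simp: playable_def)
  have N: "nbrs ?E x = {y}" "nbrs ?E y = {x}"
    using d x y by (auto simp: nbrs_insert)
  note old = isolated_class[OF x d(2)] isolated_class[OF y d(3)]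
  note new = pair_class[OF N d(2)] pair_class[OF N(2,1) d(3)]
  have "{x, y} \<subseteq> iso_verts n E"
    using old by simp
  then have "card {x, y} \<le> card (iso_verts n E)"
    by (intro card_mono) auto
  then show "2 \<le> a"
    using d pos by (simp add: position_def)
  then show "position n ?E (a - 2, b + 1, c)"
    using pos d card_verts_insert[of "{x, y}" x y E n] x y
    by (intro position_insertI[OF pos play])
      (simp_all add: position_def Int_insert_left old new)
qed

text \<open>The pair \<open>y\<close>, \<open>w\<close> disappears: \<open>y\<close> becomes inner,
  while \<open>x\<close> and \<open>w\<close> are the ends of a new path on three vertices.\<close>

lemma position_iso_pair:
  assumes pos: "position n E (a, b, c)" and play: "playable n E x y"
    and x: "nbrs E x = {}" and y: "nbrs E y = {w}" "nbrs E w = {y}"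
  shows "1 \<le> a" "1 \<le> b" "position n (insert {x, y} E) (a - 1, b - 1, c + 1)"
proof -
  let ?E = "insert {x, y} E"
  have E: "E \<subseteq> all_edges {..<n}"
    using pos by (simp add: position_def)
  have d: "x \<noteq> y" "x < n" "y < n"
    using play by (auto simp: playable_def)
  have w: "w \<noteq> y" "w \<noteq> x" "w < n"
    using nbrs_edge[OF E, of w y] x y by auto
  have N: "nbrs ?E x = {y}" "nbrs ?E y = {x, w}" "nbrs ?E w = {y}"
    using d x y w by (auto simp: nbrs_insert)
  have "nbrs ?E y \<noteq> {x}" "nbrs ?E y \<noteq> {w}"
    using N w by auto
  note new = end_class[OF N(1) this(1) d(2)] end_class[OF N(3) this(2) w(3)]
    inner_class[of x ?E y w, unfolded N, simplified, OF w(2)[symmetric]]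
  note old = isolated_class[OF x d(2)] pair_class[OF y d(3)] pair_class[OF y(2,1) w(3)]
  have "{x} \<subseteq> iso_verts n E" "{y, w} \<subseteq> pair_verts n E"
    using old by simp_all
  then have "card {x} \<le> card (iso_verts n E)" "card {y, w} \<le> card (pair_verts n E)"
    by (intro card_mono; simp)+
  then show "1 \<le> a" "1 \<le> b"
    using w pos by (simp_all add: position_def)
  then show "position n ?E (a - 1, b - 1, c + 1)"
    using pos d w card_verts_insert[of "{x, y, w}" x y E n] x y
    by (intro position_insertI[OF pos play])
      (simp_all add: position_def Int_insert_left old new)
qed

text \<open>The path is extended: \<open>x\<close> takes over the role of \<open>y\<close> as an
  end.\<close>

lemma position_iso_end:
  assumes pos: "position n E (a, b, c)" and play: "playable n E x y"
    and x: "nbrs E x = {}" and y: "nbrs E y = {w}" "nbrs E w \<noteq> {y}"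
  shows "1 \<le> a" "1 \<le> c" "position n (insert {x, y} E) (a - 1, b, c)"
proof -
  let ?E = "insert {x, y} E"
  have E: "E \<subseteq> all_edges {..<n}"
    using pos by (simp add: position_def)
  have d: "x \<noteq> y" "x < n" "y < n"
    using play by (auto simp: playable_def)
  have w: "w \<noteq> y" "w \<noteq> x" "w < n" "y \<in> nbrs E w"
    using nbrs_edge[OF E, of w y] nbrs_sym[of y E w] x y by auto
  \<comment> \<open>The neighbourhood of \<open>w\<close> contains \<open>y\<close> but is not
    \<open>{y}\<close>, so \<open>w\<close> has a second neighbour and is inner both before and
    after the move.\<close>
  obtain z where z: "z \<in> nbrs E w" "y \<noteq> z"
    using w(4) y(2) by blast
  have N: "nbrs ?E x = {y}" "nbrs ?E y = {x, w}" "nbrs ?E w = nbrs E w"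
    using d x y w by (auto simp: nbrs_insert)
  have "nbrs ?E y \<noteq> {x}"
    using N w by auto
  note new = end_class[OF N(1) this d(2)]
    inner_class[of x ?E y w, unfolded N, simplified, OF w(2)[symmetric]]
    inner_class[of y ?E w z, unfolded N, OF w(4) z]
  note old = isolated_class[OF x d(2)] end_class[OF y d(3)] inner_class[OF w(4) z]
  have "{x} \<subseteq> iso_verts n E" "{y} \<subseteq> end_verts n E"
    using old by simp_all
  then have "card {x} \<le> card (iso_verts n E)" "card {y} \<le> card (end_verts n E)"
    by (intro card_mono; simp)+
  then show "1 \<le> a" "1 \<le> c"
    using pos by (simp_all add: position_def)
  then show "position n ?E (a - 1, b, c)"
    using pos d w card_verts_insert[of "{x, y, w}" x y E n] x y
    by (intro position_insertI[OF pos play])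
      (simp_all add: position_def Int_insert_left old new)
qed

text \<open>Four pair vertices are lost: \<open>x\<close> and \<open>y\<close> become inner,
  \<open>u\<close> and \<open>w\<close> become the ends of a path on four vertices.\<close>

lemma position_pair_pair:
  assumes pos: "position n E (a, b, c)" and play: "playable n E x y"
    and x: "nbrs E x = {u}" "nbrs E u = {x}" and y: "nbrs E y = {w}" "nbrs E w = {y}"
  shows "2 \<le> b" "position n (insert {x, y} E) (a, b - 2, c + 1)"
proof -
  let ?E = "insert {x, y} E"
  have E: "E \<subseteq> all_edges {..<n}"
    using pos by (simp add: position_def)
  have d: "x \<noteq> y" "x < n" "y < n" "u \<noteq> y"
    using play x by (auto simp: playable_def)
  have w: "w \<noteq> y" "w \<noteq> x" "w < n" "u \<noteq> x" "u \<noteq> w" "u < n"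
    using nbrs_edge[OF E, of w y] nbrs_edge[OF E, of u x] x y d by auto
  have N: "nbrs ?E x = {y, u}" "nbrs ?E y = {x, w}" "nbrs ?E u = {x}" "nbrs ?E w = {y}"
    using d x y w by (auto simp: nbrs_insert)
  have "nbrs ?E x \<noteq> {u}" "nbrs ?E y \<noteq> {w}"
    using N w d by auto
  note new = end_class[OF N(3) this(1) w(6)] end_class[OF N(4) this(2) w(3)]
    inner_class[of x ?E y w, unfolded N, simplified, OF w(2)[symmetric]]
    inner_class[of y ?E x u, unfolded N, simplified, OF d(4)[symmetric]]
  note old = pair_class[OF x d(2)] pair_class[OF y d(3)] pair_class[OF x(2,1) w(6)]
    pair_class[OF y(2,1) w(3)]
  have "{x, y, u, w} \<subseteq> pair_verts n E"
    using old by simp_all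
  then have "card {x, y, u, w} \<le> card (pair_verts n E)"
    by (intro card_mono) auto
  then show "2 \<le> b"
    using w d pos by (auto simp: position_def)
  then show "position n ?E (a, b - 2, c + 1)"
    using pos d w card_verts_insert[of "{x, y, u, w}" x y E n] x y
    by (intro position_insertI[OF pos play])
      (simp_all add: position_def Int_insert_left old new)
qed

text \<open>The single edge is absorbed by the path: \<open>u\<close> replaces \<open>y\<close> as
  an end, and \<open>x\<close> and \<open>y\<close> become inner.\<close>

lemma position_pair_end:
  assumes pos: "position n E (a, b, c)" and play: "playable n E x y"
    and x: "nbrs E x = {u}" "nbrs E u = {x}" and y: "nbrs E y = {w}" "nbrs E w \<noteq> {y}"
  shows "1 \<le> b" "1 \<le> c" "position n (insert {x, y} E) (a, b - 1, c)"
proof -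
  let ?E = "insert {x, y} E"
  have E: "E \<subseteq> all_edges {..<n}"
    using pos by (simp add: position_def)
  have d: "x \<noteq> y" "x < n" "y < n" "u \<noteq> y"
    using play x by (auto simp: playable_def)
  have w: "w \<noteq> y" "w \<noteq> x" "w < n" "u \<noteq> x" "u \<noteq> w" "u < n" "y \<in> nbrs E w"
    using nbrs_edge[OF E, of w y] nbrs_edge[OF E, of u x] nbrs_sym[of y E w] x y d by auto
  obtain z where z: "z \<in> nbrs E w" "y \<noteq> z"
    using w(7) y(2) by blast
  have N: "nbrs ?E x = {y, u}" "nbrs ?E y = {x, w}" "nbrs ?E u = {x}" "nbrs ?E w = nbrs E w"
    using d x y w by (auto simp: nbrs_insert)
  have "nbrs ?E x \<noteq> {u}"
    using N w d by auto
  note new = end_class[OF N(3) this(1) w(6)]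
    inner_class[of x ?E y w, unfolded N, simplified, OF w(2)[symmetric]]
    inner_class[of y ?E x u, unfolded N, simplified, OF d(4)[symmetric]]
    inner_class[of y ?E w z, unfolded N, OF w(7) z]
  note old = pair_class[OF x d(2)] end_class[OF y d(3)] pair_class[OF x(2,1) w(6)]
    inner_class[OF w(7) z]
  have "{x, u} \<subseteq> pair_verts n E" "{y} \<subseteq> end_verts n E"
    using old by simp_all
  then have "card {x, u} \<le> card (pair_verts n E)" "card {y} \<le> card (end_verts n E)"
    by (intro card_mono; simp)+
  then show "1 \<le> b" "1 \<le> c"
    using w d pos by (auto simp: position_def)
  then show "position n ?E (a, b - 1, c)"
    using pos d w card_verts_insert[of "{x, y, u, w}" x y E n] x y
    by (intro position_insertI[OF pos play])
      (simp_all add: position_def Int_insert_left old new)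
qed

text \<open>Both \<open>x\<close> and \<open>y\<close> become inner, whether they end the same path
  or two different ones. This is why closing and joining need no distinction; \<open>u = w\<close>
  is possible, when a path on three vertices is closed.\<close>

lemma position_end_end:
  assumes pos: "position n E (a, b, c)" and play: "playable n E x y"
    and x: "nbrs E x = {u}" "nbrs E u \<noteq> {x}" and y: "nbrs E y = {w}" "nbrs E w \<noteq> {y}"
  shows "1 \<le> c" "position n (insert {x, y} E) (a, b, c - 1)"
proof -
  let ?E = "insert {x, y} E"
  have E: "E \<subseteq> all_edges {..<n}"
    using pos by (simp add: position_def)
  have d: "x \<noteq> y" "x < n" "y < n" "u \<noteq> y" "w \<noteq> x"
    using play x y nbrs_sym[of x E y] by (auto simp: playable_def)
  have w: "w \<noteq> y" "u \<noteq> x" "y \<in> nbrs E w" "x \<in> nbrs E u"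
    using nbrs_edge[OF E, of w y] nbrs_edge[OF E, of u x] nbrs_sym[of y E w] nbrs_sym[of x E u]
      x y d by auto
  obtain z where z: "z \<in> nbrs E w" "y \<noteq> z"
    using w(3) y(2) by blast
  obtain t where t: "t \<in> nbrs E u" "x \<noteq> t"
    using w(4) x(2) by blast
  have N: "nbrs ?E x = {y, u}" "nbrs ?E y = {x, w}" "nbrs ?E u = nbrs E u" "nbrs ?E w = nbrs E w"
    using d x y w by (auto simp: nbrs_insert)
  note new =
    inner_class[of x ?E y w, unfolded N, simplified, OF d(5)[symmetric]]
    inner_class[of y ?E x u, unfolded N, simplified, OF d(4)[symmetric]]
    inner_class[of y ?E w z, unfolded N, OF w(3) z]
    inner_class[of x ?E u t, unfolded N, OF w(4) t]
  note old = end_class[OF x d(2)] end_class[OF y d(3)] inner_class[OF w(3) z]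
    inner_class[OF w(4) t]
  have "{x, y} \<subseteq> end_verts n E"
    using old by simp_all
  then have "card {x, y} \<le> card (end_verts n E)"
    by (intro card_mono; simp)+
  then show "1 \<le> c"
    using d pos by (auto simp: position_def)
  then show "position n ?E (a, b, c - 1)"
    using pos d w card_verts_insert[of "{x, y, u, w}" x y E n] x y
    by (intro position_insertI[OF pos play])
      (simp_all add: position_def Int_insert_left old new)
qed

section \<open>Correspondence between moves on graphs and on triples\<close>

text \<open>Both ends of a legal move have degree at most 1, so each is isolated, in a single edge,
  or an end of a longer path.\<close>

lemma legal_move_successor:
  assumes pos: "position n E s" and e: "e \<in> legal_moves (star_graph 4) n E"
  obtains s' where "s' \<in> successors s" "position n (insert e E) s'"
proof -
  obtain a b c where s: "s = (a, b, c)"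
    by (cases s)
  note pos' = pos[unfolded s]
  \<comment> \<open>\<open>kind\<close> only serves to order the two ends of the new edge, which leaves six cases.\<close>
  define kind where "kind v =
    (if nbrs E v = {} then 0 else if \<exists>w. nbrs E v = {w} \<and> nbrs E w = {v} then 1 else 2 :: nat)" for v
  obtain x y where e: "e = {x, y}" and xy: "playable n E x y" "kind x \<le> kind y"
    using e playable_sym unfolding legal_moves_eq[OF pos]
    by (smt (verit) insert_commute mem_Collect_eq nle_le)
  have E: "E \<subseteq> all_edges {..<n}"
    using pos' by (simp add: position_def)
  have kinds: "nbrs E v = {} \<and> kind v = 0 \<or> (\<exists>w. nbrs E v = {w} \<and> nbrs E w = {v}) \<and> kind v = 1
      \<or> (\<exists>w. nbrs E v = {w} \<and> nbrs E w \<noteq> {v}) \<and> kind v = 2" if "card (nbrs E v) \<le> 1" for v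
  proof (cases "nbrs E v = {}")
    case False
    then have "card (nbrs E v) = 1"
      using that finite_nbrs[OF _ E, of v] by (simp add: le_Suc_eq)
    then obtain w where "nbrs E v = {w}"
      by (auto simp: card_1_singleton_iff)
    then show ?thesis
      by (auto simp: kind_def)
  qed (simp add: kind_def)
  have "card (nbrs E x) \<le> 1" "card (nbrs E y) \<le> 1"
    using xy by (auto simp: playable_def)
  \<comment> \<open>The order of the kinds discards three of the nine combinations.\<close>
  from kinds[OF this(1)] kinds[OF this(2)] xy(2)
  consider "nbrs E x = {}" "nbrs E y = {}"
    | w where "nbrs E x = {}" "nbrs E y = {w}" "nbrs E w = {y}"
    | w where "nbrs E x = {}" "nbrs E y = {w}" "nbrs E w \<noteq> {y}"
    | u w where "nbrs E x = {u}" "nbrs E u = {x}" "nbrs E y = {w}" "nbrs E w = {y}"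
    | u w where "nbrs E x = {u}" "nbrs E u = {x}" "nbrs E y = {w}" "nbrs E w \<noteq> {y}"
    | u w where "nbrs E x = {u}" "nbrs E u \<noteq> {x}" "nbrs E y = {w}" "nbrs E w \<noteq> {y}"
    by (elim disjE conjE exE; simp)
  then show thesis
  proof cases
    case 1
    from position_iso_iso[OF pos' xy(1) 1] show ?thesis
      by (intro that) (auto simp: e s successors_def)
  next
    case 2
    from position_iso_pair[OF pos' xy(1) 2] show ?thesis
      by (intro that) (auto simp: e s successors_def)
  next
    case 3
    from position_iso_end[OF pos' xy(1) 3] show ?thesis
      by (intro that) (auto simp: e s successors_def)
  next
    case 4
    from position_pair_pair[OF pos' xy(1) 4] show ?thesis
      by (intro that) (auto simp: e s successors_def)
  next
    case 5
    from position_pair_end[OF pos' xy(1) 5] show ?thesis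
      by (intro that) (auto simp: e s successors_def)
  next
    case 6
    from position_end_end[OF pos' xy(1) 6] show ?thesis
      by (intro that) (auto simp: e s successors_def)
  qed
qed

lemma two_elements:
  assumes "2 \<le> card S"
  obtains x y where "x \<in> S" "y \<in> S" "x \<noteq> y"
proof -
  obtain T where "T \<subseteq> S" "card T = 2"
    using assms by (rule obtain_subset_with_card_n)
  with that show thesis
    by (auto simp: card_2_iff)
qed

lemma one_element:
  assumes "1 \<le> card S"
  obtains x where "x \<in> S"
  using assms by fastforce

text \<open>The converse direction: the entries of the triple guarantee vertices of the required
  classes, and joining them is legal.\<close>

lemma successor_legal_move:
  assumes pos: "position n E s" and s': "s' \<in> successors s"
  obtains e where "e \<in> legal_moves (star_graph 4) n E" "position n (insert e E) s'"
proof -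
  obtain a b c where s: "s = (a, b, c)"
    by (cases s)
  note pos' = pos[unfolded s]
  have E: "E \<subseteq> all_edges {..<n}" and card: "card (iso_verts n E) = a"
      "card (pair_verts n E) = 2 * b" "card (end_verts n E) = 2 * c"
    using pos' by (simp_all add: position_def)
  note result = that
  have thesisI: thesis if "playable n E x y" "position n (insert {x, y} E) s'" for x y
    using that legal_moves_eq[OF pos] by (intro result[of "{x, y}"]) auto
  have isoE: "v < n" "nbrs E v = {}" if "v \<in> iso_verts n E" for v
    using that by (auto simp: iso_verts_def)
  have pairE: "v < n" "\<exists>w. nbrs E v = {w} \<and> nbrs E w = {v}" if "v \<in> pair_verts n E" for v
    using that by (auto simp: pair_verts_def)
  have endE: "v < n" "\<exists>w. nbrs E v = {w} \<and> nbrs E w \<noteq> {v}" if "v \<in> end_verts n E" for v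
    using that by (auto simp: end_verts_def)
  from s' consider "2 \<le> a" "s' = (a - 2, b + 1, c)"
    | "1 \<le> a" "1 \<le> b" "s' = (a - 1, b - 1, c + 1)"
    | "1 \<le> a" "1 \<le> c" "s' = (a - 1, b, c)"
    | "2 \<le> b" "s' = (a, b - 2, c + 1)"
    | "1 \<le> b" "1 \<le> c" "s' = (a, b - 1, c)"
    | "1 \<le> c" "s' = (a, b, c - 1)"
    by (auto simp: s successors_def split: if_splits)
  then show thesis
  proof cases
    case 1
    then obtain x y where "x \<in> iso_verts n E" "y \<in> iso_verts n E" "x \<noteq> y"
      using card two_elements by metis
    note xy = isoE[OF this(1)] isoE[OF this(2)] this(3)
    then have p: "playable n E x y"
      by (simp add: playable_def)
    show ?thesis
      using position_iso_iso(2)[OF pos' p xy(2,4)] 1 by (intro thesisI[OF p]) simp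
  next
    case 2
    then obtain x y where "x \<in> iso_verts n E" "y \<in> pair_verts n E"
      using card one_element by (metis mult_2 trans_le_add1)
    then obtain w where xy: "x < n" "nbrs E x = {}" "y < n" "nbrs E y = {w}" "nbrs E w = {y}"
      using isoE pairE by metis
    then have p: "playable n E x y"
      by (auto simp: playable_def)
    show ?thesis
      using position_iso_pair(3)[OF pos' p xy(2,4,5)] 2 by (intro thesisI[OF p]) simp
  next
    case 3
    then obtain x y where "x \<in> iso_verts n E" "y \<in> end_verts n E"
      using card one_element by (metis mult_2 trans_le_add1)
    then obtain w where xy: "x < n" "nbrs E x = {}" "y < n" "nbrs E y = {w}" "nbrs E w \<noteq> {y}"
      using isoE endE by metis
    then have p: "playable n E x y"
      by (auto simp: playable_def)
    show ?thesis
      using position_iso_end(3)[OF pos' p xy(2,4,5)] 3 by (intro thesisI[OF p]) simp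
  next
    case 4
    then obtain x where "x \<in> pair_verts n E"
      using card one_element by (metis mult_2 trans_le_add1 one_le_numeral order_trans)
    then obtain u where x: "x < n" "nbrs E x = {u}" "nbrs E u = {x}"
      using pairE by metis
    \<comment> \<open>Of at least four pair vertices, some \<open>y\<close> remains after removing
      both ends of the first single edge, and so lies in a different one.\<close>
    have "card (pair_verts n E) - card {x, u} \<le> card (pair_verts n E - {x, u})"
      by (rule diff_card_le_card_Diff) simp
    moreover have "card {x, u} \<le> 2"
      by (simp add: card_insert_le_m1)
    ultimately have "1 \<le> card (pair_verts n E - {x, u})"
      using 4 card by linarith
    then obtain y where "y \<in> pair_verts n E" "y \<noteq> x" "y \<noteq> u"
      using one_element by blast
    then obtain w where y: "y < n" "nbrs E y = {w}" "nbrs E w = {y}" "y \<noteq> x" "y \<noteq> u"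
      using pairE by metis
    then have p: "playable n E x y"
      using x by (auto simp: playable_def)
    show ?thesis
      using position_pair_pair(2)[OF pos' p x(2,3) y(2,3)] 4 by (intro thesisI[OF p]) simp
  next
    case 5
    then obtain x y where "x \<in> pair_verts n E" "y \<in> end_verts n E"
      using card one_element by (metis mult_2 trans_le_add1)
    then obtain u w where xy: "x < n" "nbrs E x = {u}" "nbrs E u = {x}"
        "y < n" "nbrs E y = {w}" "nbrs E w \<noteq> {y}"
      using pairE endE by metis
    then have p: "playable n E x y"
      by (auto simp: playable_def)
    show ?thesis
      using position_pair_end(3)[OF pos' p xy(2,3,5,6)] 5 by (intro thesisI[OF p]) simp
  next
    case 6
    then have "2 \<le> card (end_verts n E)"
      using card by simp
    then obtain x y where "x \<in> end_verts n E" "y \<in> end_verts n E" "x \<noteq> y"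
      using two_elements by metis
    then obtain u w where xy: "x < n" "nbrs E x = {u}" "nbrs E u \<noteq> {x}"
        "y < n" "nbrs E y = {w}" "nbrs E w \<noteq> {y}" "x \<noteq> y"
      using endE by metis
    \<comment> \<open>Two adjacent vertices of degree 1 would form a single edge, so distinct
      members of \<open>end_verts\<close> are never adjacent.\<close>
    then have p: "playable n E x y"
      using nbrs_sym[of x E y] by (auto simp: playable_def)
    show ?thesis
      using position_end_end(2)[OF pos' p xy(2,3,5,6)] 6 by (intro thesisI[OF p]) simp
  qed
qed

section \<open>Evaluation of the game\<close>

lemma position_empty: "position n {} (n, 0, 0)"
  by (auto simp: position_def vert_defs)

text \<open>The vertices of degree 2 are those outside the three classes, and the score counts
  them.\<close>

lemma score_position:
  assumes "position n E (a, b, c)"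
  shows "score (path_graph 3) ({..<n}, E) = n - (a + 2 * b + 2 * c)"
proof -
  have E: "E \<subseteq> all_edges {..<n}" and deg: "\<And>v. card (nbrs E v) \<le> 2"
    and card: "card (iso_verts n E) = a" "card (pair_verts n E) = 2 * b" "card (end_verts n E) = 2 * c"
    using assms by (auto simp: position_def)
  have fin: "finite (nbrs E v)" for v
    using finite_nbrs[OF _ E] by simp
  have "card (nbrs E v) = 0 \<or> card (nbrs E v) = 1 \<or> card (nbrs E v) = 2" for v
    using deg[of v] by linarith
  then have "{v \<in> {..<n}. card (nbrs E v) = 2} =
      {..<n} - (iso_verts n E \<union> pair_verts n E \<union> end_verts n E)"
    using fin by (fastforce simp: vert_defs card_1_singleton_iff)
  moreover have "card (iso_verts n E \<union> pair_verts n E \<union> end_verts n E) = a + 2 * b + 2 * c"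
    by (subst card_Un_disjoint, simp, simp, force simp: vert_defs)+ (simp add: card)
  moreover have "iso_verts n E \<union> pair_verts n E \<union> end_verts n E \<subseteq> {..<n}"
    by (auto simp: vert_defs)
  ultimately show ?thesis
    using score_path_graph_3[OF _ E deg] by (simp add: card_Diff_subset)
qed

text \<open>The terminal triples are thus \<open>(0, 0, 0)\<close>, \<open>(1, 0, 0)\<close> and
  \<open>(0, 1, 0)\<close>.\<close>

lemma successors_empty_iff: "successors (a, b, c) = {} \<longleftrightarrow> \<not> (2 \<le> a + b + c \<or> 0 < c)"
  by (auto simp: successors_def)

text \<open>Induction on \<open>a + b + c\<close>, which every move lowers by one; the recursion for
  \<open>deficit\<close> matches that of the game.\<close>

lemma game_value_position:
  assumes "position n E s"
  shows "game_value (path_graph 3) (star_graph 4) n p E = n - deficit p s"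
  using assms
proof (induction "case s of (a, b, c) \<Rightarrow> a + b + c" arbitrary: E s p rule: less_induct)
  case less
  obtain a b c where s: "s = (a, b, c)"
    by (cases s)
  note pos = less.prems
  let ?L = "legal_moves (star_graph 4) n E"
  let ?V = "\<lambda>q e. game_value (path_graph 3) (star_graph 4) n q (insert e E)"
  have fin: "finite ?L"
    by (rule finite_subset[of _ "Pow {..<n}"]) (auto simp: legal_moves_def all_edges_def)
  have IH: "game_value (path_graph 3) (star_graph 4) n q F = n - deficit q s'"
    if "s' \<in> successors s" "position n F s'" for q F s'
    using that by (intro less.hyps) (auto simp: s successors_def split: if_splits)
  \<comment> \<open>Different edges may lead to the same triple, but maximum and minimum depend only
    on the set of values, which the two directions of the correspondence identify.\<close>
  have range: "?V q ` ?L = (\<lambda>s'. n - deficit q s') ` successors s" for q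
  proof (intro equalityI image_subsetI)
    fix e assume "e \<in> ?L"
    then obtain s' where "s' \<in> successors s" "position n (insert e E) s'"
      using legal_move_successor[OF pos] by blast
    then show "?V q e \<in> (\<lambda>s'. n - deficit q s') ` successors s"
      using IH by auto
  next
    fix s' assume s': "s' \<in> successors s"
    then obtain e where "e \<in> ?L" "position n (insert e E) s'"
      using successor_legal_move[OF pos] by blast
    then show "n - deficit q s' \<in> ?V q ` ?L"
      using IH[OF s'] by (metis image_eqI)
  qed
  have fin_succ: "finite (successors s)"
    by (simp add: s successors_def)
  show ?case
  proof (cases "successors s = {}")
    case True
    then have "?L = {}"
      using range[of p] by simp
    then have "game_value (path_graph 3) (star_graph 4) n p E = n - (a + 2 * b + 2 * c)"
      using score_position[OF pos[unfolded s]] by (subst game_value.simps) simp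
    moreover have "(a, b, c) \<in> {(0, 0, 0), (1, 0, 0), (0, 1, 0)}"
      using True by (auto simp: s successors_empty_iff)
    \<comment> \<open>In a terminal triple the deficit is the number of vertices of degree less than
      2.\<close>
    then have "deficit p (a, b, c) = a + 2 * b + 2 * c"
      by (cases p) auto
    ultimately show ?thesis
      by (simp add: s)
  next
    case False
    then have L: "?L \<noteq> {}"
      using range[of p] by auto
    have attainable: "2 \<le> a + b + c \<or> 0 < c"
      using False by (simp add: s successors_empty_iff)
    show ?thesis
    proof (cases p)
      case Max_Player
      have "game_value (path_graph 3) (star_graph 4) n p E =
          Max ((\<lambda>s'. n - deficit Mini_Player s') ` successors s)"
        using L by (subst game_value.simps) (simp add: Max_Player range)
      also have "\<dots> = n - deficit Max_Player s"
      proof (rule antisym)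
        \<comment> \<open>Truncated subtraction from \<open>n\<close> is antitone, so bounds on
          deficits become bounds on scores without comparing them with \<open>n\<close>.\<close>
        show "Max ((\<lambda>s'. n - deficit Mini_Player s') ` successors s) \<le> n - deficit Max_Player s"
          using deficit_Max_le[of a b c] fin_succ False
          by (subst Max_le_iff) (auto simp: s diff_le_mono2 simp del: deficit.simps)
        obtain s' where "s' \<in> successors s" "deficit Mini_Player s' \<le> deficit Max_Player s"
          using deficit_Max_attained[OF attainable] s by blast
        then show "n - deficit Max_Player s \<le> Max ((\<lambda>s'. n - deficit Mini_Player s') ` successors s)"
          using fin_succ False by (subst Max_ge_iff)
            (auto intro!: bexI[of _ s'] diff_le_mono2 simp del: deficit.simps)
      qed
      finally show ?thesis
        by (simp add: Max_Player)
    next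
      case Mini_Player
      have "game_value (path_graph 3) (star_graph 4) n p E =
          Min ((\<lambda>s'. n - deficit Max_Player s') ` successors s)"
        using L by (subst game_value.simps) (simp add: Mini_Player range)
      also have "\<dots> = n - deficit Mini_Player s"
      proof (rule antisym)
        show "n - deficit Mini_Player s \<le> Min ((\<lambda>s'. n - deficit Max_Player s') ` successors s)"
          using deficit_Mini_ge[of a b c] fin_succ False
          by (subst Min_ge_iff) (auto simp: s diff_le_mono2 simp del: deficit.simps)
        obtain s' where "s' \<in> successors s" "deficit Mini_Player s \<le> deficit Max_Player s'"
          using deficit_Mini_attained[OF attainable] s by blast
        then show "Min ((\<lambda>s'. n - deficit Max_Player s') ` successors s) \<le> n - deficit Mini_Player s"
          using fin_succ False by (subst Min_le_iff)
            (auto intro!: bexI[of _ s'] diff_le_mono2 simp del: deficit.simps)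
      qed
      finally show ?thesis
        by (simp add: Mini_Player)
    qed
  qed
qed

lemma sat_score_eq:
  "sat_score i n (path_graph 3) (star_graph 4) =
    n - deficit (if i = 1 then Max_Player else Mini_Player) (n, 0, 0)"
  unfolding sat_score_def by (rule game_value_position[OF position_empty])

theorem theorem1p2:
  shows "let s = (\<lambda>i n. sat_score i n (path_graph 3) (star_graph 4)) in
    (s 1 1 = 1 - 1 \<and> s 1 2 = 2 - 2 \<and> s 1 3 = 3 \<and> s 1 4 = 4 \<and>
     s 1 5 = 5 - 1 \<and> s 1 6 = 6 \<and> s 1 7 = 7) \<and>
    (s 2 1 = 1 - 1 \<and> s 2 2 = 2 - 2 \<and> s 2 3 = 3 \<and> s 2 4 = 4 \<and>
     s 2 5 = 5 \<and> s 2 6 = 6 - 1 \<and> s 2 7 = 7) \<and>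
    (\<forall>n \<ge> 8. \<forall>i \<in> {1, 2}. s i n = (if even n \<noteq> even i then n else n - 1))"
  unfolding Let_def sat_score_eq
proof (intro conjI allI impI ballI)
  fix n i :: nat
  assume "8 \<le> n" "i \<in> {1, 2}"
  \<comment> \<open>The clauses with \<open>a \<ge> 9\<close> cover \<open>n \<ge> 9\<close>. For
    \<open>n = 8\<close>, parity settles the case of Max to move, and the clause with
    \<open>a \<ge> 6\<close> that of Mini.\<close>
  moreover from this(1) have "n = 8 \<or> 9 \<le> n"
    by linarith
  ultimately show "n - deficit (if i = 1 then Max_Player else Mini_Player) (n, 0, 0) =
      (if even n \<noteq> even i then n else n - 1)"
    by auto
qed simp_all

end
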